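(* Let $s$ be a Bosbach state on a bounded pseudo-BCK algebra $A$. The following are equivalent: (a) $s$ is an extremal Bosbach state; (b) $s(x\vee_1 y)=\max\{s(x),s(y)\}$ for all $x,y\in A$; (c) $s(x\vee_2 y)=\max\{s(x),s(y)\}$ for all $x,y\in A$; (d) $s$ is a state-morphism; (e) $\mathrm{Ker}(s)$ is a maximal filter of $A$.
   Context: A pseudo-BCK algebra is a structure $(A,\le,\rightarrow,\rightsquigarrow,1)$ with $\le$ a binary relation, $\rightarrow,\rightsquigarrow$ binary operations and $1\in A$, such that for all $x,y,z\in A$: $x\rightarrow y\le (y\rightarrow z)\rightsquigarrow(x\rightarrow z)$ and $x\rightsquigarrow y\le (y\rightsquigarrow z)\rightarrow(x\rightsquigarrow z)$; $x\le (x\rightarrow y)\rightsquigarrow y$ and $x\le (x\rightsquigarrow y)\rightarrow y$; $x\le x$; $x\le 1$; antisymmetry of $\le$; $x\le y$ iff $x\rightarrow y=1$ iff $x\rightsquigarrow y=1$. It is bounded if it has a least element $0$. Set $x\vee_1 y=(x\rightarrow y)\rightsquigarrow y$ and $x\vee_2 y=(x\rightsquigarrow y)\rightarrow y$. A filter is a set $F\ni 1$ with $a, a\rightarrow b\in F\Rightarrow b\in F$; it is maximal if it is a proper subset of $A$ not properly contained in another proper filter. A Bosbach state is a map $s:A\to[0,1]$ with $s(x)+s(x\rightarrow y)=s(y)+s(y\rightarrow x)$, $s(x)+s(x\rightsquigarrow y)=s(y)+s(y\rightsquigarrow x)$ for all $x,y$, $s(0)=0$, $s(1)=1$; $\mathrm{Ker}(s)=\{a: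 s(a)=1\}$. A Bosbach state $s$ is extremal if whenever $0<\lambda<1$ and $s_1,s_2$ are Bosbach states with $s=\lambda s_1+(1-\lambda)s_2$, then $s_1=s_2$. A state-morphism is a map $m:A\to[0,1]$ with $m(0)=0$ and $m(x\rightarrow y)=m(x\rightsquigarrow y)=\min\{1-m(x)+m(y),1\}$ for all $x,y\in A$. *)

theory Defs
  imports Complex_Main
begin

text \<open>
  The algebra A is rendered as a type of the class below, so that a statement about an arbitrary
  type of the class is a statement about an arbitrary algebra.
  The order is a separate parameter rather than the one of class \<open>order\<close>: transitivity is
  not among the axioms but a consequence of them.
\<close>

class pseudo_bck = one +
  fixes bck_le :: "'a \<Rightarrow> 'a \<Rightarrow> bool"  (infix "\<sqsubseteq>" 50)
    and imp1 :: "'a \<Rightarrow> 'a \<Rightarrow> 'a"  (infixr "\<rightarrow>" 60)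
    and imp2 :: "'a \<Rightarrow> 'a \<Rightarrow> 'a"  (infixr "\<leadsto>" 60)
  assumes imp1_trans: "x \<rightarrow> y \<sqsubseteq> (y \<rightarrow> z) \<leadsto> (x \<rightarrow> z)"
    and imp2_trans: "x \<leadsto> y \<sqsubseteq> (y \<leadsto> z) \<rightarrow> (x \<leadsto> z)"
    and le_imp1_imp2: "x \<sqsubseteq> (x \<rightarrow> y) \<leadsto> y"
    and le_imp2_imp1: "x \<sqsubseteq> (x \<leadsto> y) \<rightarrow> y"
    and bck_le_refl: "x \<sqsubseteq> x"
    and bck_le_one: "x \<sqsubseteq> 1"
    and bck_le_antisym: "x \<sqsubseteq> y \<Longrightarrow> y \<sqsubseteq> x \<Longrightarrow> x = y"
    and bck_le_iff_imp1: "x \<sqsubseteq> y \<longleftrightarrow> x \<rightarrow> y = 1"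
    and bck_le_iff_imp2: "x \<sqsubseteq> y \<longleftrightarrow> x \<leadsto> y = 1"

class bounded_pseudo_bck = pseudo_bck + zero +
  assumes zero_bck_le: "0 \<sqsubseteq> x"

definition vee1 :: "'a::pseudo_bck \<Rightarrow> 'a \<Rightarrow> 'a"  (infixl "\<squnion>\<^sub>1" 65) where
  "x \<squnion>\<^sub>1 y = (x \<rightarrow> y) \<leadsto> y"

definition vee2 :: "'a::pseudo_bck \<Rightarrow> 'a \<Rightarrow> 'a"  (infixl "\<squnion>\<^sub>2" 65) where
  "x \<squnion>\<^sub>2 y = (x \<leadsto> y) \<rightarrow> y"

definition bck_filter :: "'a::pseudo_bck set \<Rightarrow> bool" where
  "bck_filter F \<longleftrightarrow> 1 \<in> F \<and> (\<forall>a b. a \<in> F \<longrightarrow> a \<rightarrow> b \<in> F \<longrightarrow> b \<in> F)"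

definition maximal_filter :: "'a::pseudo_bck set \<Rightarrow> bool" where
  "maximal_filter F \<longleftrightarrow>
     bck_filter F \<and> F \<noteq> UNIV \<and> \<not> (\<exists>G. bck_filter G \<and> G \<noteq> UNIV \<and> F \<subset> G)"

definition bosbach_state :: "('a::bounded_pseudo_bck \<Rightarrow> real) \<Rightarrow> bool" where
  "bosbach_state s \<longleftrightarrow>
     (\<forall>x. s x \<in> {0..1}) \<and>
     (\<forall>x y. s x + s (x \<rightarrow> y) = s y + s (y \<rightarrow> x)) \<and>
     (\<forall>x y. s x + s (x \<leadsto> y) = s y + s (y \<leadsto> x)) \<and>
     s 0 = 0 \<and> s 1 = 1"

definition Ker :: "('a::bounded_pseudo_bck \<Rightarrow> real) \<Rightarrow> 'a set" where
  "Ker s = {a. s a = 1}"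

definition extremal_bosbach_state :: "('a::bounded_pseudo_bck \<Rightarrow> real) \<Rightarrow> bool" where
  "extremal_bosbach_state s \<longleftrightarrow>
     bosbach_state s \<and>
     (\<forall>c s1 s2. 0 < c \<longrightarrow> c < 1 \<longrightarrow> bosbach_state s1 \<longrightarrow> bosbach_state s2 \<longrightarrow>
        s = (\<lambda>x. c * s1 x + (1 - c) * s2 x) \<longrightarrow> s1 = s2)"

definition state_morphism :: "('a::bounded_pseudo_bck \<Rightarrow> real) \<Rightarrow> bool" where
  "state_morphism m \<longleftrightarrow>
     (\<forall>x. m x \<in> {0..1}) \<and>
     m 0 = 0 \<and>
     (\<forall>x y. m (x \<rightarrow> y) = min (1 - m x + m y) 1 \<and> m (x \<leadsto> y) = min (1 - m x + m y) 1)"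

end

(*
  The state of both joins of x and y is the least state of an upper bound of x and y, so (b), (c)
  and (d) coincide. If (d) fails, prelinearity modulo the kernel yields a and b with
  s (a \<squnion>\<^sub>1 b) = 1 but s a, s b < 1. The elements c with s (c \<rightarrow> b) = s b then form a proper filter
  strictly above Ker s, and the limits of the states of a \<rightarrow> ... \<rightarrow> a \<rightarrow> x exhibit s as a proper
  convex combination of its conditional states on a = 1 and a < 1. Conversely, a state-morphism m
  is determined by its kernel among all states: fractional parts of n * m x are values of m, and
  comparing the growth in n shows that every state s with Ker m \<subseteq> Ker s equals m.
*)

theory Submission
  imports Defs
begin

section \<open>Pseudo-BCK algebras\<close>

context pseudo_bck
begin

lemma one_le_iff: "1 \<sqsubseteq> x \<longleftrightarrow> x = 1"
  using bck_le_antisym bck_le_one bck_le_refl by blast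

lemma one_imp1 [simp]: "1 \<rightarrow> x = x"
  by (metis bck_le_antisym bck_le_iff_imp1 bck_le_iff_imp2 bck_le_refl le_imp1_imp2 le_imp2_imp1 one_le_iff)

lemma one_imp2 [simp]: "1 \<leadsto> x = x"
  by (metis bck_le_antisym bck_le_iff_imp1 bck_le_iff_imp2 bck_le_refl le_imp1_imp2 le_imp2_imp1 one_le_iff)

lemma imp1_self [simp]: "x \<rightarrow> x = 1"
  using bck_le_iff_imp1 bck_le_refl by blast

lemma imp2_self [simp]: "x \<leadsto> x = 1"
  using bck_le_iff_imp2 bck_le_refl by blast

lemma bck_le_trans: "x \<sqsubseteq> y \<Longrightarrow> y \<sqsubseteq> z \<Longrightarrow> x \<sqsubseteq> z"
  by (metis bck_le_iff_imp1 imp1_trans one_imp2 one_le_iff)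

lemma imp1_antimono: "x \<sqsubseteq> y \<Longrightarrow> y \<rightarrow> z \<sqsubseteq> x \<rightarrow> z"
  by (metis bck_le_iff_imp1 bck_le_iff_imp2 imp1_trans one_le_iff)

lemma imp2_antimono: "x \<sqsubseteq> y \<Longrightarrow> y \<leadsto> z \<sqsubseteq> x \<leadsto> z"
  by (metis bck_le_iff_imp1 bck_le_iff_imp2 imp2_trans one_le_iff)

lemma imp1_mono: "x \<sqsubseteq> y \<Longrightarrow> z \<rightarrow> x \<sqsubseteq> z \<rightarrow> y"
  by (metis bck_le_iff_imp1 imp1_trans one_imp2)

lemma imp2_mono: "x \<sqsubseteq> y \<Longrightarrow> z \<leadsto> x \<sqsubseteq> z \<leadsto> y"
  by (metis bck_le_iff_imp2 imp2_trans one_imp1)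

text \<open>Apply antitonicity to \<open>y \<sqsubseteq> (y \<rightarrow> z) \<leadsto> z\<close>;
  the converse is the mirror image.\<close>

lemma le_imp1_iff_le_imp2: "x \<sqsubseteq> y \<rightarrow> z \<longleftrightarrow> y \<sqsubseteq> x \<leadsto> z"
  by (meson bck_le_trans imp1_antimono imp2_antimono le_imp1_imp2 le_imp2_imp1)

lemma le_imp1: "y \<sqsubseteq> x \<rightarrow> y"
  by (simp add: le_imp1_iff_le_imp2 bck_le_one)

lemma le_imp2: "y \<sqsubseteq> x \<leadsto> y"
  using le_imp1_iff_le_imp2 bck_le_one imp1_self by metis

lemma imp1_le_imp1_imp1: "x \<rightarrow> y \<sqsubseteq> (z \<rightarrow> x) \<rightarrow> (z \<rightarrow> y)"
  by (simp add: le_imp1_iff_le_imp2 imp1_trans)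

lemma imp1_imp2_commute: "x \<rightarrow> (y \<leadsto> z) = y \<leadsto> (x \<rightarrow> z)"
proof (rule bck_le_antisym)
  show "x \<rightarrow> (y \<leadsto> z) \<sqsubseteq> y \<leadsto> (x \<rightarrow> z)"
    using bck_le_trans imp1_trans imp2_antimono le_imp2_imp1 by blast
  show "y \<leadsto> (x \<rightarrow> z) \<sqsubseteq> x \<rightarrow> (y \<leadsto> z)"
    using bck_le_trans imp2_trans imp1_antimono le_imp1_imp2 by blast
qed

lemma funpow_imp1_commute: "(imp1 a ^^ n) (x \<leadsto> y) = x \<leadsto> (imp1 a ^^ n) y"
  by (induction n) (simp_all add: imp1_imp2_commute)

lemma funpow_imp2_commute: "(imp2 a ^^ n) (x \<rightarrow> y) = x \<rightarrow> (imp2 a ^^ n) y"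
  by (induction n) (simp_all add: imp1_imp2_commute)

end

lemma le_vee1: "x \<sqsubseteq> x \<squnion>\<^sub>1 y" "y \<sqsubseteq> x \<squnion>\<^sub>1 y"
  by (simp_all add: vee1_def le_imp1_imp2 le_imp2)

lemma le_vee2: "x \<sqsubseteq> x \<squnion>\<^sub>2 y" "y \<sqsubseteq> x \<squnion>\<^sub>2 y"
  by (simp_all add: vee2_def le_imp2_imp1 le_imp1)

lemma vee1_imp1: "(x \<squnion>\<^sub>1 y) \<rightarrow> y = x \<rightarrow> y"
  by (simp add: vee1_def bck_le_antisym imp1_antimono le_imp1_imp2 le_imp2_imp1)

lemma vee2_imp2: "(x \<squnion>\<^sub>2 y) \<leadsto> y = x \<leadsto> y"
  by (simp add: vee2_def bck_le_antisym imp2_antimono le_imp1_imp2 le_imp2_imp1)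

lemma vee1_mono: "x \<sqsubseteq> w \<Longrightarrow> x \<squnion>\<^sub>1 y \<sqsubseteq> w \<squnion>\<^sub>1 y"
  by (simp add: vee1_def imp1_antimono imp2_antimono)

lemma vee2_mono: "x \<sqsubseteq> w \<Longrightarrow> x \<squnion>\<^sub>2 y \<sqsubseteq> w \<squnion>\<^sub>2 y"
  by (simp add: vee2_def imp1_antimono imp2_antimono)

lemma bck_filter_eq_UNIV:
  fixes F :: "'a::bounded_pseudo_bck set"
  assumes "bck_filter F" "0 \<in> F"
  shows "F = UNIV"
proof -
  have "0 \<rightarrow> b = 1" for b :: 'a
    using bck_le_iff_imp1 zero_bck_le by blast
  then show ?thesis
    using assms unfolding bck_filter_def by (metis UNIV_eq_I)
qed

section \<open>Bosbach states\<close>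

context
  fixes s :: "'a::bounded_pseudo_bck \<Rightarrow> real"
  assumes state: "bosbach_state s"
begin

lemma state_bounds: "0 \<le> s x" "s x \<le> 1"
  using state unfolding bosbach_state_def by auto

lemma state_one [simp]: "s 1 = 1"
  using state unfolding bosbach_state_def by auto

lemma state_zero [simp]: "s 0 = 0"
  using state unfolding bosbach_state_def by auto

lemma bosbach1: "s x + s (x \<rightarrow> y) = s y + s (y \<rightarrow> x)"
  using state unfolding bosbach_state_def by auto

lemma bosbach2: "s x + s (x \<leadsto> y) = s y + s (y \<leadsto> x)"
  using state unfolding bosbach_state_def by auto

lemma state_imp1_of_le:
  assumes "x \<sqsubseteq> y" shows "s (y \<rightarrow> x) = 1 - s y + s x"
proof -
  have "x \<rightarrow> y = 1" using assms bck_le_iff_imp1 by blast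
  then show ?thesis using bosbach1[of x y] by simp
qed

lemma state_imp2_of_le:
  assumes "x \<sqsubseteq> y" shows "s (y \<leadsto> x) = 1 - s y + s x"
proof -
  have "x \<leadsto> y = 1" using assms bck_le_iff_imp2 by blast
  then show ?thesis using bosbach2[of x y] by simp
qed

lemma state_mono: "x \<sqsubseteq> y \<Longrightarrow> s x \<le> s y"
  using state_imp1_of_le[of x y] state_bounds(2)[of "y \<rightarrow> x"] by simp

lemma state_imp1_vee1: "s (x \<rightarrow> y) = 1 + s y - s (x \<squnion>\<^sub>1 y)"
  using state_imp1_of_le[OF le_vee1(2)[of y x]] by (simp add: vee1_imp1)

lemma state_imp2_vee2: "s (x \<leadsto> y) = 1 + s y - s (x \<squnion>\<^sub>2 y)"
  using state_imp2_of_le[OF le_vee2(2)[of y x]] by (simp add: vee2_imp2)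

text \<open>The join \<open>w \<squnion>\<^sub>1 y\<close> lies above \<open>x \<squnion>\<^sub>1 y\<close>, but has the state of \<open>w\<close>.\<close>

lemma state_vee1_le: "x \<sqsubseteq> w \<Longrightarrow> y \<sqsubseteq> w \<Longrightarrow> s (x \<squnion>\<^sub>1 y) \<le> s w"
  using state_mono[OF vee1_mono, of x w y] state_imp1_vee1[of w y] state_imp1_of_le[of y w]
  by simp

lemma state_vee2_le: "x \<sqsubseteq> w \<Longrightarrow> y \<sqsubseteq> w \<Longrightarrow> s (x \<squnion>\<^sub>2 y) \<le> s w"
  using state_mono[OF vee2_mono, of x w y] state_imp2_vee2[of w y] state_imp2_of_le[of y w]
  by simp

lemma state_vee2: "s (x \<squnion>\<^sub>2 y) = s (x \<squnion>\<^sub>1 y)"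
  by (simp add: order.antisym state_vee1_le state_vee2_le le_vee1 le_vee2)

lemma state_imp2_vee1: "s (x \<leadsto> y) = 1 + s y - s (x \<squnion>\<^sub>1 y)"
  by (simp add: state_imp2_vee2 state_vee2)

lemma state_imp2: "s (x \<leadsto> y) = s (x \<rightarrow> y)"
  by (simp add: state_imp2_vee1 state_imp1_vee1)

lemma state_vee1_commute: "s (x \<squnion>\<^sub>1 y) = s (y \<squnion>\<^sub>1 x)"
  by (simp add: order.antisym state_vee1_le le_vee1)

lemma state_vee1_mono:
  assumes "x \<sqsubseteq> x'" "y \<sqsubseteq> y'" shows "s (x \<squnion>\<^sub>1 y) \<le> s (x' \<squnion>\<^sub>1 y')"
  using assms by (meson bck_le_trans le_vee1 state_vee1_le)

lemma state_le_vee1: "s x \<le> s (x \<squnion>\<^sub>1 y)" "s y \<le> s (x \<squnion>\<^sub>1 y)"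
  by (simp_all add: state_mono le_vee1)

text \<open>The state of an implication is \<open>1 + s y\<close> minus the state of the join, and
  \<open>min (1 - s x + s y) 1\<close> is \<open>1 + s y\<close> minus the maximum.\<close>

lemma state_morphism_iff_vee1:
  "state_morphism s \<longleftrightarrow> (\<forall>x y. s (x \<squnion>\<^sub>1 y) = max (s x) (s y))"
proof -
  have "s (x \<rightarrow> y) = min (1 - s x + s y) 1 \<longleftrightarrow> s (x \<squnion>\<^sub>1 y) = max (s x) (s y)" for x y
    unfolding state_imp1_vee1 by (auto simp: min_def max_def)
  then show ?thesis
    unfolding state_morphism_def by (auto simp: state_imp2 state_bounds)
qed

text \<open>This extends \<open>state_vee1_le\<close> to upper bounds modulo the kernel: joining
  \<open>x\<close> and then \<open>y\<close> to \<open>t\<close> gives a true upper bound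
  \<open>q\<close> with the state of \<open>t\<close>.\<close>

lemma state_vee1_le_of_imp1_eq_1:
  assumes "s (x \<rightarrow> t) = 1" "s (y \<rightarrow> t) = 1"
  shows "s (x \<squnion>\<^sub>1 y) \<le> s t"
proof -
  define p where "p = x \<squnion>\<^sub>1 t"
  define q where "q = y \<squnion>\<^sub>1 p"
  have p: "s p = s t"
    using assms(1) state_imp1_vee1[of x t] by (simp add: p_def)
  have "s (y \<rightarrow> t) \<le> s (y \<rightarrow> p)"
    by (simp add: p_def state_mono imp1_mono le_vee1)
  then have "s (y \<rightarrow> p) = 1"
    using assms(2) state_bounds(2)[of "y \<rightarrow> p"] by simp
  then have q: "s q = s p"
    using state_imp1_vee1[of y p] by (simp add: q_def)
  have "x \<sqsubseteq> q" "y \<sqsubseteq> q"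
    unfolding q_def p_def by (meson bck_le_trans le_vee1)+
  then show ?thesis
    using state_vee1_le p q by metis
qed

text \<open>
  Prelinearity holds up to the state. Writing \<open>w\<close> for the join on the left and \<open>u\<close> for
  \<open>x \<squnion>\<^sub>1 y\<close>, the element \<open>t\<close> below stands for the product of \<open>w\<close> and \<open>u\<close>, which
  dominates \<open>x\<close> and \<open>y\<close> modulo the kernel and so has state at least \<open>s u\<close>.
\<close>

lemma state_prelinear:
  "s (((x \<squnion>\<^sub>1 y) \<rightarrow> y) \<squnion>\<^sub>1 ((x \<squnion>\<^sub>1 y) \<rightarrow> x)) = 1"
proof -
  define u where "u = x \<squnion>\<^sub>1 y"
  define w where "w = (u \<rightarrow> y) \<squnion>\<^sub>1 (u \<rightarrow> x)"
  \<comment> \<open>By residuation \<open>g\<close> acts as the negation of the product of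
    \<open>w\<close> and \<open>u\<close>, so \<open>t\<close> is a double negation.\<close>
  define g where "g = w \<rightarrow> (u \<rightarrow> 0)"
  define t where "t = g \<leadsto> 0"
  have neg: "s (z \<rightarrow> 0) = 1 - s z" "s (z \<leadsto> 0) = 1 - s z" for z
    using state_imp1_of_le[OF zero_bck_le, of z] state_imp2_of_le[OF zero_bck_le, of z]
    by simp_all
  have below: "s (z \<rightarrow> t) = 1" if z: "z \<sqsubseteq> u" "u \<rightarrow> z \<sqsubseteq> w" for z
  proof -
    \<comment> \<open>This is \<open>g\<close> with \<open>u \<rightarrow> z\<close> in place of
      \<open>w\<close>. As \<open>z\<close> lies below \<open>u\<close>, it has the same state as
      the negation of \<open>z\<close>.\<close>
    define h where "h = (u \<rightarrow> z) \<rightarrow> (u \<rightarrow> 0)"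
    have "s h = 1 - s (u \<rightarrow> z) + s (u \<rightarrow> 0)"
      unfolding h_def by (rule state_imp1_of_le) (simp add: imp1_mono zero_bck_le)
    then have h: "s h = s (z \<rightarrow> 0)"
      by (simp add: neg state_imp1_of_le z)
    have "z \<rightarrow> 0 \<sqsubseteq> h"
      unfolding h_def by (rule imp1_le_imp1_imp1)
    then have "s (h \<leadsto> (z \<rightarrow> 0)) = 1"
      using h by (simp add: state_imp2_of_le)
    then have 1: "s (z \<rightarrow> (h \<leadsto> 0)) = 1"
      by (simp add: imp1_imp2_commute)
    have "h \<leadsto> 0 \<sqsubseteq> t"
      unfolding t_def g_def h_def by (intro imp2_antimono imp1_antimono z)
    then have "s (z \<rightarrow> (h \<leadsto> 0)) \<le> s (z \<rightarrow> t)"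
      by (intro state_mono imp1_mono)
    then show ?thesis
      using 1 state_bounds(2)[of "z \<rightarrow> t"] by simp
  qed
  have "s u \<le> s t"
    unfolding u_def
    by (rule state_vee1_le_of_imp1_eq_1; rule below) (simp_all add: u_def w_def le_vee1)
  then have 1: "s g \<le> 1 - s u"
    by (simp add: t_def neg)
  \<comment> \<open>This makes the state of \<open>g\<close> exactly computable; the bound on
    \<open>s g\<close> then leaves no room for \<open>s w < 1\<close>.\<close>
  have "u \<rightarrow> 0 \<sqsubseteq> w"
    unfolding w_def by (meson bck_le_trans le_vee1 imp1_mono zero_bck_le)
  then have "s g = 1 - s w + (1 - s u)"
    by (simp add: g_def state_imp1_of_le neg)
  then have "s w = 1"
    using 1 state_bounds(2)[of w] by simp
  then show ?thesis
    by (simp add: w_def u_def)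
qed

text \<open>Where the maximum formula fails, the join \<open>u\<close> of \<open>x\<close> and
  \<open>y\<close> has a state above both, so the witnesses \<open>u \<rightarrow> y\<close> and
  \<open>u \<rightarrow> x\<close> have state below 1.\<close>

lemma not_state_morphismE:
  assumes "\<not> state_morphism s"
  obtains a b where "s a < 1" "s b < 1" "s (a \<squnion>\<^sub>1 b) = 1"
proof -
  obtain x y where "s (x \<squnion>\<^sub>1 y) \<noteq> max (s x) (s y)"
    using assms state_morphism_iff_vee1 by blast
  then have "s x < s (x \<squnion>\<^sub>1 y)" "s y < s (x \<squnion>\<^sub>1 y)"
    using state_le_vee1[of x y] state_le_vee1[of y x] by (auto simp: max_def split: if_splits)
  then have "s ((x \<squnion>\<^sub>1 y) \<rightarrow> y) < 1" "s ((x \<squnion>\<^sub>1 y) \<rightarrow> x) < 1"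
    by (simp_all add: state_imp1_of_le le_vee1)
  then show ?thesis
    using that state_prelinear by blast
qed

section \<open>Filters and maximality of the kernel\<close>

lemma Ker_filter: "bck_filter (Ker s)"
  unfolding bck_filter_def Ker_def
proof (intro conjI allI impI; simp)
  fix a b assume "s a = 1" "s (a \<rightarrow> b) = 1"
  then show "s b = 1"
    using bosbach1[of a b] state_bounds(2)[of b] state_bounds(2)[of "b \<rightarrow> a"] by linarith
qed

lemma Ker_proper: "Ker s \<noteq> UNIV"
proof -
  have "0 \<notin> Ker s" by (simp add: Ker_def)
  then show ?thesis by blast
qed

text \<open>The elements disjoint from \<open>b\<close> modulo the kernel form a filter.\<close>

lemma polar_filter: "bck_filter {c. s (c \<rightarrow> b) = s b}"
  unfolding bck_filter_def
proof (intro conjI allI impI; simp)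
  fix c d assume c: "s (c \<rightarrow> b) = s b" and cd: "s ((c \<rightarrow> d) \<rightarrow> b) = s b"
  \<comment> \<open>By \<open>cd\<close> the join of \<open>c \<rightarrow> d\<close> with
    \<open>b\<close> has state 1, hence so does its join with the larger
    \<open>c \<rightarrow> b\<close>.\<close>
  have "s ((c \<rightarrow> d) \<squnion>\<^sub>1 b) \<le> s ((c \<rightarrow> d) \<squnion>\<^sub>1 (c \<rightarrow> b))"
    by (simp add: state_vee1_mono bck_le_refl le_imp1)
  then have "s ((c \<rightarrow> d) \<rightarrow> (c \<rightarrow> b)) \<le> s b"
    using c cd by (simp add: state_imp1_vee1)
  moreover have "s (d \<rightarrow> b) \<le> s ((c \<rightarrow> d) \<rightarrow> (c \<rightarrow> b))"
    by (simp add: state_mono imp1_le_imp1_imp1)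
  ultimately show "s (d \<rightarrow> b) = s b"
    using state_mono[OF le_imp1, of b d] by simp
qed

lemma state_morphism_if_maximal_Ker:
  assumes max: "maximal_filter (Ker s)"
  shows "state_morphism s"
proof (rule ccontr)
  assume "\<not> state_morphism s"
  then obtain a b where a: "s a < 1" and b: "s b < 1" and ab: "s (a \<squnion>\<^sub>1 b) = 1"
    by (rule not_state_morphismE)
  define G where "G = {c. s (c \<rightarrow> b) = s b}"
  have G: "bck_filter G"
    unfolding G_def by (rule polar_filter)
  have "0 \<rightarrow> b = 1"
    using bck_le_iff_imp1 zero_bck_le by blast
  then have "0 \<notin> G"
    using b by (simp add: G_def)
  then have "G \<noteq> UNIV"
    by blast
  moreover have "Ker s \<subseteq> G"
  proof
    fix c assume "c \<in> Ker s"
    then have "s (c \<squnion>\<^sub>1 b) = 1"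
      using state_le_vee1(1)[of c b] state_bounds(2)[of "c \<squnion>\<^sub>1 b"] by (simp add: Ker_def)
    then show "c \<in> G"
      by (simp add: G_def state_imp1_vee1)
  qed
  moreover have "a \<in> G" "a \<notin> Ker s"
    using a ab by (simp_all add: G_def state_imp1_vee1 Ker_def)
  ultimately show False
    using max G unfolding maximal_filter_def by blast
qed

text \<open>For \<open>a\<close> outside the kernel, the states of
  \<open>a \<rightarrow> ... \<rightarrow> a \<rightarrow> 0\<close> grow linearly until they reach
  1. A larger filter containing \<open>a\<close> then detaches \<open>a\<close> repeatedly and
  contains 0.\<close>

lemma maximal_Ker_if_state_morphism:
  assumes m: "state_morphism s"
  shows "maximal_filter (Ker s)"
  unfolding maximal_filter_def
proof (intro conjI notI Ker_filter)
  show "Ker s = UNIV \<Longrightarrow> False"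
    using Ker_proper by blast
  assume "\<exists>G. bck_filter G \<and> G \<noteq> UNIV \<and> Ker s \<subset> G"
  then obtain G a where G: "bck_filter G" "G \<noteq> UNIV" "Ker s \<subseteq> G" "a \<in> G" "a \<notin> Ker s"
    by blast
  then have a: "0 < 1 - s a"
    using state_bounds(2)[of a] by (simp add: Ker_def)
  have pow: "s ((imp1 a ^^ n) 0) = min (real n * (1 - s a)) 1" for n
  proof (induction n)
    case (Suc n)
    have "s ((imp1 a ^^ Suc n) 0) = min (1 - s a + s ((imp1 a ^^ n) 0)) 1"
      using m unfolding state_morphism_def by simp
    then show ?case
      using Suc a by (auto simp: min_def algebra_simps)
  qed simp
  obtain n where "1 < real n * (1 - s a)"
    using reals_Archimedean3[OF a] by blast
  then have "(imp1 a ^^ n) 0 \<in> Ker s"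
    by (simp add: Ker_def pow)
  then have "(imp1 a ^^ n) 0 \<in> G"
    using G(3) by blast
  moreover have "a \<rightarrow> c \<in> G \<Longrightarrow> c \<in> G" for c
    using G(1,4) unfolding bck_filter_def by blast
  ultimately have "0 \<in> G"
    by (induction n) simp_all
  then show False
    using G bck_filter_eq_UNIV by blast
qed

section \<open>State-morphisms are extremal\<close>

text \<open>
  The element \<open>y\<close> plays the role of the fractional part of \<open>n\<close> times \<open>x\<close>;
  both states of it lie in the unit interval, so they grow at the same rate.
\<close>

lemma state_eq_state_morphism:
  fixes m :: "'a \<Rightarrow> real"
  assumes m: "state_morphism m" and ker: "Ker m \<subseteq> Ker s"
  shows "s = m"
proof
  fix x
  have m0: "m 0 = 0" and mb: "0 \<le> m z" "m z \<le> 1"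
    and mi: "m (z \<rightarrow> z') = min (1 - m z + m z') 1" for z z'
    using m unfolding state_morphism_def by auto
  \<comment> \<open>Comparison under \<open>m\<close> replaces the order here, because
    \<open>z \<rightarrow> z'\<close> lies in both kernels.\<close>
  have si: "s (z' \<rightarrow> z) = 1 - s z' + s z" if "m z \<le> m z'" for z z'
  proof -
    have "z \<rightarrow> z' \<in> Ker m"
      using that by (simp add: Ker_def mi)
    then show ?thesis
      using ker bosbach1[of z z'] by (auto simp: Ker_def)
  qed
  have sneg: "s (z \<rightarrow> 0) = 1 - s z" for z
    using si[of 0 z] m0 mb by simp
  have mneg: "m (z \<rightarrow> 0) = 1 - m z" for z
    using mb[of z] by (simp add: mi m0)
  have ex: "\<exists>y k. m y = real n * m x - k \<and> s y = real n * s x - k" for n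
  proof (induction n)
    case 0
    show ?case by (rule exI[of _ 0], rule exI[of _ 0]) (simp add: m0)
  next
    case (Suc n)
    then obtain y k where y: "m y = real n * m x - k" "s y = real n * s x - k"
      by blast
    show ?case
    proof (cases "m y \<le> m (x \<rightarrow> 0)")
      case True
      \<comment> \<open>Without a carry, the sum of \<open>x\<close> and \<open>y\<close> is taken;
        after a carry, their product, whose value is the sum minus 1.\<close>
      have "m ((x \<rightarrow> 0) \<rightarrow> y) = m x + m y"
        using True by (simp add: mi[of "x \<rightarrow> 0"] mneg)
      moreover have "s ((x \<rightarrow> 0) \<rightarrow> y) = s x + s y"
        using si[OF True] by (simp add: sneg)
      ultimately show ?thesis
        using y by (intro exI[of _ "(x \<rightarrow> 0) \<rightarrow> y"] exI[of _ k]) (simp add: algebra_simps)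
    next
      case False
      have "m ((y \<rightarrow> (x \<rightarrow> 0)) \<rightarrow> 0) = m x + m y - 1"
        using False by (simp add: mneg[of "y \<rightarrow> (x \<rightarrow> 0)"] mi[of y] mneg)
      moreover have "s ((y \<rightarrow> (x \<rightarrow> 0)) \<rightarrow> 0) = s x + s y - 1"
        using si[of "x \<rightarrow> 0" y] False by (simp add: sneg)
      ultimately show ?thesis
        using y by (intro exI[of _ "(y \<rightarrow> (x \<rightarrow> 0)) \<rightarrow> 0"] exI[of _ "k + 1"])
          (simp add: algebra_simps)
    qed
  qed
  have "real n * \<bar>s x - m x\<bar> \<le> 1" for n
  proof -
    obtain y k where "m y = real n * m x - k" "s y = real n * s x - k"
      using ex by blast
    then have "real n * (s x - m x) = s y - m y"
      by (simp add: algebra_simps)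
    then have "\<bar>real n * (s x - m x)\<bar> \<le> 1"
      using mb[of y] state_bounds[of y] by auto
    then show ?thesis by (simp add: abs_mult)
  qed
  then have "\<not> 0 < \<bar>s x - m x\<bar>"
    using reals_Archimedean3[of "\<bar>s x - m x\<bar>"] by (meson linorder_not_le)
  then show "s x = m x"
    by simp
qed

end

text \<open>A convex combination of numbers at most 1 equals 1 only if both are 1, so both kernels
  contain \<open>Ker s\<close> and rigidity applies.\<close>

lemma extremal_if_state_morphism:
  assumes s: "bosbach_state s" and m: "state_morphism s"
  shows "extremal_bosbach_state s"
  unfolding extremal_bosbach_state_def
proof (intro conjI allI impI s)
  fix c :: real and s1 s2
  assume c: "0 < c" "c < 1" and st: "bosbach_state s1" "bosbach_state s2"
    and eq: "s = (\<lambda>x. c * s1 x + (1 - c) * s2 x)"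
  have "s1 x = 1 \<and> s2 x = 1" if "s x = 1" for x
  proof -
    have 1: "c * (1 - s1 x) + (1 - c) * (1 - s2 x) = 0"
      using that eq by (simp add: algebra_simps)
    have "0 \<le> c * (1 - s1 x)" "0 \<le> (1 - c) * (1 - s2 x)"
      using c state_bounds[OF st(1), of x] state_bounds[OF st(2), of x] by simp_all
    with 1 have "c * (1 - s1 x) = 0" "(1 - c) * (1 - s2 x) = 0"
      by linarith+
    then show ?thesis using c by simp
  qed
  then have "Ker s \<subseteq> Ker s1" "Ker s \<subseteq> Ker s2"
    by (auto simp: Ker_def)
  then show "s1 = s2"
    using state_eq_state_morphism[OF _ m] st by metis
qed

section \<open>Extremal states are state-morphisms\<close>

text \<open>
  Both \<open>imp1 a\<close> and \<open>imp2 a\<close> are instances of the operator \<open>f\<close>. In terms of measures,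
  iterating it sends every element to \<open>1\<close> where \<open>a < 1\<close> and fixes it where \<open>a = 1\<close>.
\<close>

context
  fixes s :: "'a::bounded_pseudo_bck \<Rightarrow> real" and a :: 'a and f :: "'a \<Rightarrow> 'a"
  assumes state: "bosbach_state s"
    and f_mono: "\<And>x y. x \<sqsubseteq> y \<Longrightarrow> f x \<sqsubseteq> f y"
    and le_f: "\<And>x. x \<sqsubseteq> f x"
    and state_f: "\<And>x. s (f x) = 1 + s x - s (a \<squnion>\<^sub>1 x)"
begin

lemma funpow_f_mono: "x \<sqsubseteq> y \<Longrightarrow> (f ^^ n) x \<sqsubseteq> (f ^^ n) y"
  by (induction n) (simp_all add: f_mono)

lemma le_funpow_f: "x \<sqsubseteq> (f ^^ n) x"
proof (induction n)
  case (Suc n)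
  then show ?case
    using bck_le_trans[OF _ le_f] by simp
qed (simp add: bck_le_refl)

lemma incseq_state_funpow: "incseq (\<lambda>n. s ((f ^^ n) x))"
  by (rule incseq_SucI) (simp add: state_mono[OF state] le_f)

lemma convergent_state_funpow: "convergent (\<lambda>n. s ((f ^^ n) x))"
proof -
  obtain l where "(\<lambda>n. s ((f ^^ n) x)) \<longlonglongrightarrow> l"
    using incseq_convergent[OF incseq_state_funpow, of x 1] state_bounds(2)[OF state] by metis
  then show ?thesis
    by (rule convergentI)
qed

text \<open>Each application of \<open>f\<close> gains 1 minus the state of the join with
  \<open>a\<close>, and this gain shrinks as the element grows.\<close>

lemma state_funpow_increment_antimono:
  assumes "x \<sqsubseteq> y" shows "s ((f ^^ n) y) - s y \<le> s ((f ^^ n) x) - s x"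
proof (induction n)
  case (Suc n)
  have "s (a \<squnion>\<^sub>1 (f ^^ n) x) \<le> s (a \<squnion>\<^sub>1 (f ^^ n) y)"
    by (simp add: state_vee1_mono[OF state] bck_le_refl funpow_f_mono assms)
  then show ?case
    using Suc by (simp add: state_f)
qed simp

lemma state_funpow_increment_le: "s ((f ^^ n) x) - s x \<le> real n * (s (f x) - s x)"
proof (induction n)
  case (Suc n)
  have "s (a \<squnion>\<^sub>1 x) \<le> s (a \<squnion>\<^sub>1 (f ^^ n) x)"
    by (simp add: state_vee1_mono[OF state] bck_le_refl le_funpow_f)
  then show ?case
    using Suc by (simp add: state_f algebra_simps)
qed simp

text \<open>The \<open>n\<close>-th iterate of \<open>?z\<close> bounds both arguments on the left.
  Each of its \<open>n\<close> gains is at most the gain at \<open>(f ^^ m) y\<close>, which lies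
  below \<open>?z\<close>.\<close>

lemma state_vee1_funpow_le:
  "s ((f ^^ n) x \<squnion>\<^sub>1 (f ^^ (n + m)) y)
    \<le> s (x \<squnion>\<^sub>1 (f ^^ m) y) + real n * (s ((f ^^ Suc m) y) - s ((f ^^ m) y))"
proof -
  let ?z = "x \<squnion>\<^sub>1 (f ^^ m) y"
  have "s ((f ^^ n) x \<squnion>\<^sub>1 (f ^^ (n + m)) y) \<le> s ((f ^^ n) ?z)"
    by (rule state_vee1_le[OF state]) (simp_all add: funpow_add funpow_f_mono le_vee1)
  also have "\<dots> \<le> s ?z + real n * (s (f ?z) - s ?z)"
    using state_funpow_increment_le[of n ?z] by simp
  also have "s (f ?z) - s ?z \<le> s ((f ^^ Suc m) y) - s ((f ^^ m) y)"
    using state_funpow_increment_antimono[OF le_vee1(2)[of "(f ^^ m) y" x], of 1] by simp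
  finally show ?thesis
    by (simp add: mult_left_mono)
qed

text \<open>Iterating on one side suffices: for fixed \<open>n\<close> the error term of the
  previous bound vanishes as \<open>m\<close> grows, since the states of the iterates of
  \<open>y\<close> converge.\<close>

lemma state_vee1_funpow_limit:
  assumes J: "(\<lambda>n. s ((f ^^ n) x \<squnion>\<^sub>1 (f ^^ n) y)) \<longlonglongrightarrow> L"
  shows "(\<lambda>n. s (x \<squnion>\<^sub>1 (f ^^ n) y)) \<longlonglongrightarrow> L"
proof -
  let ?K = "\<lambda>n. s (x \<squnion>\<^sub>1 (f ^^ n) y)"
  have inc: "incseq ?K"
    by (rule incseq_SucI) (simp add: state_vee1_mono[OF state] bck_le_refl le_f)
  obtain M where K: "?K \<longlonglongrightarrow> M"
    using incseq_convergent[OF inc, of 1] state_bounds(2)[OF state] by metis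
  obtain t where t: "(\<lambda>n. s ((f ^^ n) y)) \<longlonglongrightarrow> t"
    using convergent_state_funpow unfolding convergent_def by blast
  have "?K n \<le> s ((f ^^ n) x \<squnion>\<^sub>1 (f ^^ n) y)" for n
    by (simp add: state_vee1_mono[OF state] bck_le_refl le_funpow_f)
  then have "M \<le> L"
    using LIMSEQ_le[OF K J] by blast
  moreover have "s ((f ^^ n) x \<squnion>\<^sub>1 (f ^^ n) y) \<le> M" for n
  proof (rule LIMSEQ_le_const)
    have "(\<lambda>m. ?K m + real n * (s ((f ^^ Suc m) y) - s ((f ^^ m) y))) \<longlonglongrightarrow> M + real n * (t - t)"
      by (intro tendsto_intros K t LIMSEQ_Suc)
    then show "(\<lambda>m. ?K m + real n * (s ((f ^^ Suc m) y) - s ((f ^^ m) y))) \<longlonglongrightarrow> M"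
      by simp
    have "s ((f ^^ n) x \<squnion>\<^sub>1 (f ^^ n) y) \<le> s ((f ^^ n) x \<squnion>\<^sub>1 (f ^^ (n + m)) y)" for m
      by (simp add: state_vee1_mono[OF state] bck_le_refl funpow_add funpow_f_mono le_funpow_f)
    then show "\<exists>N. \<forall>m\<ge>N. s ((f ^^ n) x \<squnion>\<^sub>1 (f ^^ n) y)
        \<le> ?K m + real n * (s ((f ^^ Suc m) y) - s ((f ^^ m) y))"
      using state_vee1_funpow_le order.trans by blast
  qed
  then have "L \<le> M"
    using LIMSEQ_le_const2[OF J] by blast
  ultimately show ?thesis
    using K by simp
qed

lemma state_vee1_funpow_limits_agree:
  obtains L where "(\<lambda>n. s (x \<squnion>\<^sub>1 (f ^^ n) y)) \<longlonglongrightarrow> L" "(\<lambda>n. s (y \<squnion>\<^sub>1 (f ^^ n) x)) \<longlonglongrightarrow> L"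
proof -
  have "incseq (\<lambda>n. s ((f ^^ n) x \<squnion>\<^sub>1 (f ^^ n) y))"
    by (rule incseq_SucI) (simp add: state_vee1_mono[OF state] le_f)
  then obtain L where L: "(\<lambda>n. s ((f ^^ n) x \<squnion>\<^sub>1 (f ^^ n) y)) \<longlonglongrightarrow> L"
    using incseq_convergent[of _ 1] state_bounds(2)[OF state] by metis
  then have "(\<lambda>n. s ((f ^^ n) y \<squnion>\<^sub>1 (f ^^ n) x)) \<longlonglongrightarrow> L"
    by (subst state_vee1_commute[OF state])
  then show ?thesis
    using that state_vee1_funpow_limit L by blast
qed

end

section \<open>The limit state\<close>

context
  fixes s :: "'a::bounded_pseudo_bck \<Rightarrow> real" and a :: 'a
  assumes state: "bosbach_state s"
begin

lemmas imp1_operator = state imp1_mono le_imp1 state_imp1_vee1[OF state, of a]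
lemmas imp2_operator = state imp2_mono le_imp2 state_imp2_vee1[OF state, of a]

text \<open>The operators \<open>imp1 a\<close> and \<open>imp2 a\<close> commute and have the same state.\<close>

lemma state_funpow_imp2: "s ((imp2 a ^^ n) x) = s ((imp1 a ^^ n) x)"
proof (induction n arbitrary: x)
  case (Suc n)
  have "s ((imp2 a ^^ Suc n) x) = s ((imp1 a ^^ n) (a \<leadsto> x))"
    using Suc[of "a \<leadsto> x"] by (simp only: funpow_Suc_right o_apply)
  also have "\<dots> = s ((imp1 a ^^ Suc n) x)"
    by (simp add: funpow_imp1_commute state_imp2[OF state])
  finally show ?case .
qed simp

text \<open>For integration against a measure, this is the measure of \<open>a < 1\<close> plus the
  integral of \<open>x\<close> over \<open>a = 1\<close>.\<close>

definition limit_state :: "'a \<Rightarrow> real" where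
  "limit_state x = lim (\<lambda>n. s ((imp1 a ^^ n) x))"

lemma limit_state1: "(\<lambda>n. s ((imp1 a ^^ n) x)) \<longlonglongrightarrow> limit_state x"
  unfolding limit_state_def
  using convergent_state_funpow[OF imp1_operator] convergent_LIMSEQ_iff by blast

lemma limit_state2: "(\<lambda>n. s ((imp2 a ^^ n) x)) \<longlonglongrightarrow> limit_state x"
  using limit_state1 by (simp add: state_funpow_imp2)

text \<open>Iterates of \<open>imp2 a\<close> pass through \<open>\<rightarrow>\<close> to its
  second argument, so both implications are evaluated with a limit \<open>L\<close> that is
  symmetric in \<open>x\<close> and \<open>y\<close>.\<close>

lemma limit_state_bosbach1:
  "limit_state x + limit_state (x \<rightarrow> y) = limit_state y + limit_state (y \<rightarrow> x)"
proof -
  obtain L where L: "(\<lambda>n. s (x \<squnion>\<^sub>1 (imp2 a ^^ n) y)) \<longlonglongrightarrow> L" "(\<lambda>n. s (y \<squnion>\<^sub>1 (imp2 a ^^ n) x)) \<longlonglongrightarrow> L"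
    using state_vee1_funpow_limits_agree[OF imp2_operator] by blast
  have "limit_state (z \<rightarrow> z') = 1 + limit_state z' - L"
    if "(\<lambda>n. s (z \<squnion>\<^sub>1 (imp2 a ^^ n) z')) \<longlonglongrightarrow> L" for z z'
  proof (rule LIMSEQ_unique[OF limit_state2])
    show "(\<lambda>n. s ((imp2 a ^^ n) (z \<rightarrow> z'))) \<longlonglongrightarrow> 1 + limit_state z' - L"
      unfolding funpow_imp2_commute state_imp1_vee1[OF state]
      by (intro tendsto_intros limit_state2 that)
  qed
  from this[OF L(1)] this[OF L(2)] show ?thesis
    by simp
qed

lemma limit_state_bosbach2:
  "limit_state x + limit_state (x \<leadsto> y) = limit_state y + limit_state (y \<leadsto> x)"
proof -
  obtain L where L: "(\<lambda>n. s (x \<squnion>\<^sub>1 (imp1 a ^^ n) y)) \<longlonglongrightarrow> L" "(\<lambda>n. s (y \<squnion>\<^sub>1 (imp1 a ^^ n) x)) \<longlonglongrightarrow> L"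
    using state_vee1_funpow_limits_agree[OF imp1_operator] by blast
  have "limit_state (z \<leadsto> z') = 1 + limit_state z' - L"
    if "(\<lambda>n. s (z \<squnion>\<^sub>1 (imp1 a ^^ n) z')) \<longlonglongrightarrow> L" for z z'
  proof (rule LIMSEQ_unique[OF limit_state1])
    show "(\<lambda>n. s ((imp1 a ^^ n) (z \<leadsto> z'))) \<longlonglongrightarrow> 1 + limit_state z' - L"
      unfolding funpow_imp1_commute state_imp2_vee1[OF state]
      by (intro tendsto_intros limit_state1 that)
  qed
  from this[OF L(1)] this[OF L(2)] show ?thesis
    by simp
qed

lemma state_le_limit_state: "s x \<le> limit_state x"
  by (rule LIMSEQ_le_const[OF limit_state1])
    (auto intro!: state_mono[OF state] le_funpow_f[OF imp1_operator])

lemma limit_state_mono: "x \<sqsubseteq> y \<Longrightarrow> limit_state x \<le> limit_state y"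
  by (rule LIMSEQ_le[OF limit_state1 limit_state1])
    (auto intro!: state_mono[OF state] funpow_f_mono[OF imp1_operator])

lemma limit_state_one: "limit_state 1 = 1"
proof -
  have "limit_state 1 \<le> 1"
    by (rule LIMSEQ_le_const2[OF limit_state1]) (auto simp: state_bounds[OF state])
  then show ?thesis
    using state_le_limit_state[of 1] by (simp add: state_one[OF state])
qed

text \<open>The least element gains the most under iteration.\<close>

lemma limit_state_le: "limit_state x \<le> s x + limit_state 0"
proof (rule LIMSEQ_le[OF limit_state1])
  show "(\<lambda>n. s x + s ((imp1 a ^^ n) 0)) \<longlonglongrightarrow> s x + limit_state 0"
    by (intro tendsto_intros limit_state1)
  have "s ((imp1 a ^^ n) x) \<le> s x + s ((imp1 a ^^ n) 0)" for n
    using state_funpow_increment_antimono[OF imp1_operator zero_bck_le, of n x]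
    by (simp add: state_zero[OF state])
  then show "\<exists>N. \<forall>n\<ge>N. s ((imp1 a ^^ n) x) \<le> s x + s ((imp1 a ^^ n) 0)"
    by blast
qed

lemma limit_state_zero_pos:
  assumes "s a < 1" shows "0 < limit_state 0"
proof -
  have "s (a \<rightarrow> 0) \<le> limit_state 0"
    using incseq_le[OF incseq_state_funpow[OF imp1_operator] limit_state1[of 0], of 1]
    by simp
  then show ?thesis
    using assms state_imp1_of_le[OF state zero_bck_le, of a] by (simp add: state_zero[OF state])
qed

text \<open>The first gain of \<open>b\<close> is zero and bounds all later ones.\<close>

lemma limit_state_disjoint:
  assumes "s (a \<squnion>\<^sub>1 b) = 1" shows "limit_state b = s b"
proof -
  have "limit_state b \<le> s b"
  proof (rule LIMSEQ_le_const2[OF limit_state1])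
    have "s ((imp1 a ^^ n) b) \<le> s b" for n
      using state_funpow_increment_le[OF imp1_operator, of n b] assms
      by (simp add: state_imp1_vee1[OF state])
    then show "\<exists>N. \<forall>n\<ge>N. s ((imp1 a ^^ n) b) \<le> s b"
      by blast
  qed
  then show ?thesis
    using state_le_limit_state[of b] by simp
qed

end

text \<open>
  If \<open>s\<close> is integration against a measure, then \<open>s1\<close> and \<open>s2\<close> below are the conditional
  states on \<open>a < 1\<close> and \<open>a = 1\<close>; the first of these events has measure \<open>t\<close>.
\<close>

lemma state_morphism_if_extremal:
  fixes s :: "'a::bounded_pseudo_bck \<Rightarrow> real"
  assumes ext: "extremal_bosbach_state s"
  shows "state_morphism s"
proof (rule ccontr)
  have state: "bosbach_state s"
    using ext unfolding extremal_bosbach_state_def by blast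
  assume "\<not> state_morphism s"
  then obtain a b where a: "s a < 1" and b: "s b < 1" and ab: "s (a \<squnion>\<^sub>1 b) = 1"
    by (rule not_state_morphismE[OF state])
  define T where "T = limit_state s a"
  define t where "t = T 0"
  note T_defs = T_def t_def
  have Tb: "T b = s b"
    using limit_state_disjoint[OF state ab] by (simp add: T_def)
  have t0: "0 < t"
    using limit_state_zero_pos[OF state a] by (simp add: T_defs)
  have T_ge: "t \<le> T x" for x
    using limit_state_mono[OF state zero_bck_le, of a x] by (simp add: T_defs)
  have t1: "t < 1"
    using T_ge[of b] Tb b by simp
  have T1: "T 1 = 1"
    using limit_state_one[OF state] by (simp add: T_def)
  have T_le: "T x \<le> 1" for x
    using limit_state_mono[OF state bck_le_one, of a x] T1 by (simp add: T_def)
  have sT: "s x \<le> T x" "T x \<le> s x + t" for x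
    using state_le_limit_state[OF state, of x a] limit_state_le[OF state, of a x] by (simp_all add: T_defs)
  have B1: "T x + T (x \<rightarrow> y) = T y + T (y \<rightarrow> x)" for x y
    using limit_state_bosbach1[OF state] by (simp add: T_def)
  have B2: "T x + T (x \<leadsto> y) = T y + T (y \<leadsto> x)" for x y
    using limit_state_bosbach2[OF state] by (simp add: T_def)
  define s1 where "s1 x = (s x - T x + t) / t" for x
  define s2 where "s2 x = (T x - t) / (1 - t)" for x
  have "bosbach_state s1"
    unfolding bosbach_state_def
  proof (intro conjI allI)
    show "s1 x \<in> {0..1}" for x
      using sT[of x] t0 by (simp add: s1_def divide_simps)
    show "s1 x + s1 (x \<rightarrow> y) = s1 y + s1 (y \<rightarrow> x)" for x y
      using B1[of x y] bosbach1[OF state, of x y]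
      by (simp add: s1_def add_divide_distrib[symmetric])
    show "s1 x + s1 (x \<leadsto> y) = s1 y + s1 (y \<leadsto> x)" for x y
      using B2[of x y] bosbach2[OF state, of x y]
      by (simp add: s1_def add_divide_distrib[symmetric])
    show "s1 0 = 0" "s1 1 = 1"
      using t0 T1 by (simp_all add: s1_def t_def state_zero[OF state] state_one[OF state])
  qed
  moreover have "bosbach_state s2"
    unfolding bosbach_state_def
  proof (intro conjI allI)
    show "s2 x \<in> {0..1}" for x
      using T_ge[of x] T_le[of x] t1 by (simp add: s2_def divide_simps)
    show "s2 x + s2 (x \<rightarrow> y) = s2 y + s2 (y \<rightarrow> x)" for x y
      using B1[of x y] by (simp add: s2_def add_divide_distrib[symmetric])
    show "s2 x + s2 (x \<leadsto> y) = s2 y + s2 (y \<leadsto> x)" for x y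
      using B2[of x y] by (simp add: s2_def add_divide_distrib[symmetric])
    show "s2 0 = 0" "s2 1 = 1"
      using t1 T1 by (simp_all add: s2_def t_def)
  qed
  moreover have "s = (\<lambda>x. t * s1 x + (1 - t) * s2 x)"
    using t0 t1 by (simp add: s1_def s2_def)
  ultimately have "s1 = s2"
    using ext t0 t1 unfolding extremal_bosbach_state_def by blast
  \<comment> \<open>The element \<open>b\<close> separates the two: \<open>T b = s b\<close> gives
    \<open>s1 b = 1\<close>, while \<open>s b < 1\<close> gives \<open>s2 b < 1\<close>.\<close>
  then have "s1 b = s2 b"
    by simp
  then show False
    using t0 t1 b Tb by (simp add: s1_def s2_def divide_simps)
qed

theorem theorem3p26:
  fixes s :: "'a::bounded_pseudo_bck \<Rightarrow> real"
  assumes "bosbach_state s"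
  shows "(extremal_bosbach_state s \<longleftrightarrow> (\<forall>x y. s (x \<squnion>\<^sub>1 y) = max (s x) (s y))) \<and>
         (extremal_bosbach_state s \<longleftrightarrow> (\<forall>x y. s (x \<squnion>\<^sub>2 y) = max (s x) (s y))) \<and>
         (extremal_bosbach_state s \<longleftrightarrow> state_morphism s) \<and>
         (extremal_bosbach_state s \<longleftrightarrow> maximal_filter (Ker s))"
proof -
  have "extremal_bosbach_state s \<longleftrightarrow> state_morphism s"
    using extremal_if_state_morphism[OF assms] state_morphism_if_extremal by blast
  moreover have "maximal_filter (Ker s) \<longleftrightarrow> state_morphism s"
    using state_morphism_if_maximal_Ker[OF assms] maximal_Ker_if_state_morphism[OF assms] by blast
  ultimately show ?thesis
    by (simp add: state_vee2[OF assms] state_morphism_iff_vee1[OF assms])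
qed

end
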